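(* Let $A$ and $B$ be self-adjoint operators on a separable Hilbert space $\mathcal{H}$, with $B$ bounded and nonnegative. Then for every $\phi\in\mathcal{H}$, $$\sum_{n\in\mathbb{Z}}\ \sup_{y\in[0,1]}\ \Big\langle B\phi,\ \frac{1}{(A+(n+y)B)^2+1}\,B\phi\Big\rangle \le \pi\|B\|(1+\|B\|)\|\phi\|^2.$$ *)

theory Defs
  imports "HOL-Analysis.Analysis"
begin

definition separable_space :: "'a::topological_space itself \<Rightarrow> bool" where
  "separable_space _ \<longleftrightarrow> (\<exists>S::'a set. countable S \<and> closure S = UNIV)"

text \<open>A (possibly unbounded) operator is given by its domain D and a function A,
  whose values outside D are irrelevant.  Self-adjointness in the usual sense:
  densely defined, linear on a subspace, symmetric, and the adjoint's domain
  is contained in D.\<close>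
definition self_adjoint_op :: "'a::real_inner set \<Rightarrow> ('a \<Rightarrow> 'a) \<Rightarrow> bool" where
  "self_adjoint_op D A \<longleftrightarrow>
     subspace D \<and> closure D = UNIV \<and>
     (\<forall>x\<in>D. \<forall>y\<in>D. A (x + y) = A x + A y) \<and>
     (\<forall>x\<in>D. \<forall>c. A (c *\<^sub>R x) = c *\<^sub>R A x) \<and>
     (\<forall>x\<in>D. \<forall>y\<in>D. inner (A x) y = inner x (A y)) \<and>
     (\<forall>y z. (\<forall>x\<in>D. inner (A x) y = inner x z) \<longrightarrow> y \<in> D)"

definition sq_resolvent :: "'a::real_vector set \<Rightarrow> ('a \<Rightarrow> 'a) \<Rightarrow> 'a \<Rightarrow> 'a" where
  "sq_resolvent D T v = (THE u. u \<in> D \<and> T u \<in> D \<and> T (T u) + u = v)"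

end

theory Submission
  imports Defs "HOL-Complex_Analysis.Complex_Analysis" "HOL-Real_Asymp.Real_Asymp"
begin

text \<open>Put \<open>\<psi> = B \<phi>\<close>, \<open>R(z) = (A + z B + \<i>)\<^sup>-\<^sup>1\<close> and \<open>H(z) = - \<langle>\<psi>, R(z) \<psi>\<rangle>\<close> for \<open>Im z \<ge> 0\<close>. On the
  real line \<open>f(s) = Im H(s)\<close> is the function whose suprema are summed. \<open>H\<close> is bounded and
  holomorphic with nonnegative imaginary part, and the Cauchy-Schwarz inequality for the form
  \<open>\<langle>B x, y\<rangle>\<close> gives \<open>\<eta> Im H(\<i> \<eta>) \<le> \<langle>B \<phi>, \<phi>\<rangle>\<close>. By the Poisson formula \<open>\<pi> \<eta> Im H(\<i> \<eta>)\<close> is the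
  integral of \<open>\<eta>\<^sup>2 / (s\<^sup>2 + \<eta>\<^sup>2) f(s)\<close>, so \<open>\<eta> \<rightarrow> \<infinity>\<close> yields \<open>\<integral> f \<le> \<pi> \<langle>B \<phi>, \<phi>\<rangle>\<close>. Finally the resolvent
  identity gives \<open>|f'| \<le> \<parallel>B\<parallel> f\<close>, hence the supremum of \<open>f\<close> over a unit interval is at most
  \<open>1 + \<parallel>B\<parallel>\<close> times its integral there.\<close>

section \<open>Poisson kernel estimates on the upper half-plane\<close>

lemma integral_inverse_square_le:
  fixes R \<eta> :: real
  assumes R: "0 < R" and \<eta>: "0 < \<eta>"
  shows "integral {-R..R} (\<lambda>s. 1 / (s\<^sup>2 + \<eta>\<^sup>2)) \<le> pi / \<eta>"
proof -
  have "((\<lambda>s. 1 / (s\<^sup>2 + \<eta>\<^sup>2)) has_integral arctan (R / \<eta>) / \<eta> - arctan (- R / \<eta>) / \<eta>) {-R..R}"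
  proof (rule fundamental_theorem_of_calculus)
    fix s :: real
    have "((\<lambda>s. arctan (s / \<eta>) / \<eta>) has_real_derivative inverse (1 + (s / \<eta>)\<^sup>2) * (1 / \<eta>) / \<eta>)
        (at s within {-R..R})"
      using \<eta> by (auto intro!: derivative_eq_intros)
    also have "inverse (1 + (s / \<eta>)\<^sup>2) * (1 / \<eta>) / \<eta> = 1 / ((1 + (s / \<eta>)\<^sup>2) * \<eta>\<^sup>2)"
      by (simp add: divide_inverse power2_eq_square)
    also have "(1 + (s / \<eta>)\<^sup>2) * \<eta>\<^sup>2 = s\<^sup>2 + \<eta>\<^sup>2"
      using \<eta> by (simp add: distrib_right power_divide)
    finally have "((\<lambda>s. arctan (s / \<eta>) / \<eta>) has_real_derivative 1 / (s\<^sup>2 + \<eta>\<^sup>2))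
        (at s within {-R..R})" .
    then show "((\<lambda>s. arctan (s / \<eta>) / \<eta>) has_vector_derivative 1 / (s\<^sup>2 + \<eta>\<^sup>2)) (at s within {-R..R})"
      by (rule has_real_derivative_iff_has_vector_derivative[THEN iffD1])
  qed (use R in simp)
  then have "integral {-R..R} (\<lambda>s. 1 / (s\<^sup>2 + \<eta>\<^sup>2)) = 2 * arctan (R / \<eta>) / \<eta>"
    by (simp add: integral_unique arctan_minus)
  also have "\<dots> \<le> pi / \<eta>"
    using arctan_ubound[of "R / \<eta>"] \<eta> by (intro divide_right_mono) auto
  finally show ?thesis .
qed

text \<open>Cauchy's theorem on the boundary of the half disc of radius \<open>R\<close>, applied to
  \<open>(H z - H w0) / (z\<^sup>2 + \<eta>\<^sup>2)\<close> with \<open>w0 = \<i> * \<eta>\<close>.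
  On the arc the numerator is at most \<open>2 * K\<close>, the denominator at least
  \<open>R\<^sup>2 - \<eta>\<^sup>2\<close>, and the length is \<open>R * pi\<close>; this is the
  error term on the right.\<close>

lemma upper_half_plane_poisson_bound:
  fixes H :: "complex \<Rightarrow> complex"
  assumes cont: "continuous_on {z. 0 \<le> Im z} H" and holo: "H holomorphic_on {z. 0 < Im z}"
    and bound: "\<And>z. 0 \<le> Im z \<Longrightarrow> norm (H z) \<le> K"
    and \<eta>: "0 < \<eta>" and R: "\<eta> < R"
  shows "integral {-R..R} (\<lambda>s. (Im (H (of_real s)) - Im (H (\<i> * of_real \<eta>))) / (s\<^sup>2 + \<eta>\<^sup>2))
    \<le> 2 * K * R * pi / (R\<^sup>2 - \<eta>\<^sup>2)"
proof -
  define w0 where "w0 = \<i> * complex_of_real \<eta>"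
  \<comment> \<open>Subtracting the value at the pole \<open>w0\<close> of the Poisson kernel makes the integrand
    regular in the half-plane, so no winding number is needed.\<close>
  define k where "k = (\<lambda>z. if z = w0 then deriv H w0 else (H z - H w0) / (z - w0))"
  define q where "q = (\<lambda>z. k z / (z + w0))"
  define S where "S = {z. 0 \<le> Im z}"
  have R0: "0 < R" and K0: "0 \<le> K"
    using \<eta> R order_trans[OF norm_ge_zero bound[of 0]] by auto
  have w0: "0 < Im w0" "norm w0 = \<eta>" "w0 * w0 = - of_real (\<eta>\<^sup>2)"
    using \<eta> by (auto simp: w0_def norm_mult power2_eq_square algebra_simps)
  have nz: "z + w0 \<noteq> 0" if "0 \<le> Im z" for z
    using that w0(1) by (metis add_nonneg_pos less_irrefl plus_complex.sel(2) zero_complex.sel(2))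
  have kholo: "k holomorphic_on {z. 0 < Im z}"
    unfolding k_def by (rule pole_lemma_open[OF holo open_halfspace_Im_gt])
  have kcont: "continuous_on S k"
    unfolding continuous_on_eq_continuous_within
  proof
    fix z assume z: "z \<in> S"
    show "continuous (at z within S) k"
    proof (cases "0 < Im z")
      case True
      then have "isCont k z"
        using holomorphic_on_imp_continuous_on[OF kholo] open_halfspace_Im_gt[of 0]
        by (auto simp: continuous_on_eq_continuous_at)
      then show ?thesis
        by (rule continuous_at_imp_continuous_at_within)
    next
      \<comment> \<open>Here \<open>z\<close> lies on the real axis, so near \<open>z\<close> the
        case distinction in \<open>k\<close> never meets \<open>w0\<close>.\<close>
      case False
      then have zw: "z \<noteq> w0"
        using w0(1) by auto
      have "continuous (at z within S) (\<lambda>z. (H z - H w0) / (z - w0))"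
        using cont z zw unfolding S_def continuous_on_eq_continuous_within
        by (intro continuous_intros) auto
      then show ?thesis
      proof (rule continuous_transform_within[OF _ _ z])
        show "0 < dist z w0" using zw by simp
        show "(H x - H w0) / (x - w0) = k x" if "x \<in> S" "dist x z < dist z w0" for x
          using that by (auto simp: k_def dist_commute)
      qed
    qed
  qed
  have qcont: "continuous_on S q"
    unfolding q_def using nz by (intro continuous_intros kcont) (auto simp: S_def)
  have qholo: "q holomorphic_on {z. 0 < Im z}"
    unfolding q_def using nz by (intro holomorphic_intros kholo) auto
  have qeq: "q z = (H z - H w0) / (z\<^sup>2 + of_real (\<eta>\<^sup>2))" if "z \<noteq> w0" for z
    using that w0(3) by (simp add: q_def k_def power2_eq_square algebra_simps)
  let ?l = "linepath (- complex_of_real R) (of_real R)" and ?c = "part_circlepath 0 R 0 pi"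
  have intS: "interior S = {z. 0 < Im z}"
    using interior_halfspace_ge[of \<i> 0] by (simp add: S_def inner_complex_def)
  have lS: "path_image ?l \<subseteq> S"
    using closed_segment_subset[of "- complex_of_real R" S "of_real R"]
    by (simp add: S_def convex_halfspace_Im_ge)
  have circle: "Im z \<ge> 0 \<and> norm z = R" if "z \<in> path_image ?c" for z
  proof -
    have "z \<in> (\<lambda>t. of_real R * exp (\<i> * complex_of_real t)) ` {0..pi}"
      using that by (auto simp: path_image_part_circlepath[OF pi_ge_zero])
    then obtain t where "z = of_real R * exp (\<i> * of_real t)" "t \<in> {0..pi}"
      by (rule imageE)
    then show ?thesis
      using R0 by (simp add: norm_mult Im_exp sin_ge_zero)
  qed
  then have cS: "path_image ?c \<subseteq> S"
    by (auto simp: S_def)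
  have join: "pathfinish ?l = pathstart ?c"
    by simp
  \<comment> \<open>This form of Cauchy's theorem asks for continuity on the convex set
    \<open>S\<close> but differentiability only in its interior, so the contour may run along the
    real axis.\<close>
  have "(q has_contour_integral 0) (?l +++ ?c)"
  proof (rule Cauchy_theorem_convex[OF qcont _ finite.emptyI])
    show "convex S"
      unfolding S_def by (rule convex_halfspace_Im_ge)
    show "q field_differentiable at x" if "x \<in> interior S - {}" for x
      using that intS qholo open_halfspace_Im_gt[of 0] holomorphic_on_imp_differentiable_at by auto
    show "valid_path (?l +++ ?c)"
      by (intro valid_path_join) auto
    show "path_image (?l +++ ?c) \<subseteq> S"
      using lS cS by (auto simp: path_image_join)
    show "pathfinish (?l +++ ?c) = pathstart (?l +++ ?c)"
      by (simp add: exp_eq_polar)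
  qed
  then have "contour_integral (?l +++ ?c) q = 0"
    by (rule contour_integral_unique)
  moreover have il: "q contour_integrable_on ?l"
    by (rule contour_integrable_continuous_linepath[OF continuous_on_subset[OF qcont lS[unfolded path_image_linepath]]])
  moreover have ic: "q contour_integrable_on ?c"
    by (rule contour_integrable_continuous_part_circlepath[OF continuous_on_subset[OF qcont cS]])
  ultimately have sum0: "contour_integral ?l q + contour_integral ?c q = 0"
    by (simp add: contour_integral_join)
  have cbound: "norm (contour_integral ?c q) \<le> 2 * K / (R\<^sup>2 - \<eta>\<^sup>2) * R * \<bar>pi - 0\<bar>"
  proof (rule contour_integral_bound_part_circlepath[OF ic])
    have pos: "0 < R\<^sup>2 - \<eta>\<^sup>2"
      using R \<eta> by (simp add: power_strict_mono)
    then show "0 \<le> 2 * K / (R\<^sup>2 - \<eta>\<^sup>2)"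
      using K0 by simp
    show "norm (q z) \<le> 2 * K / (R\<^sup>2 - \<eta>\<^sup>2)" if "z \<in> path_image ?c" for z
    proof -
      have z: "0 \<le> Im z" "norm z = R"
        using circle[OF that] by auto
      then have "z \<noteq> w0"
        using w0(2) R by auto
      moreover have "norm (H z - H w0) \<le> 2 * K"
        using norm_triangle_ineq4[of "H z" "H w0"] bound[OF z(1)] bound[of w0] w0(1) by simp
      moreover have "R\<^sup>2 - \<eta>\<^sup>2 \<le> norm (z\<^sup>2 + of_real (\<eta>\<^sup>2))"
        using norm_diff_ineq[of "z\<^sup>2" "of_real (\<eta>\<^sup>2)"] z(2) by (simp add: norm_power)
      ultimately show ?thesis
        using pos K0 by (simp add: qeq norm_divide frac_le)
    qed
  qed (use R0 in simp)
  have "((\<lambda>s. q (of_real s)) has_integral contour_integral ?l q) {-R..R}"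
    using has_contour_integral_integral[OF il] R0
    by (subst (asm) has_contour_integral_linepath_Reals_iff) auto
  then have "((\<lambda>s. Im (q (of_real s))) has_integral Im (contour_integral ?l q)) {-R..R}"
    by (rule has_integral_Im)
  \<comment> \<open>The denominator is real on the real axis, so taking imaginary parts affects the
    numerator alone.\<close>
  moreover have "Im (q (of_real s)) = (Im (H (of_real s)) - Im (H w0)) / (s\<^sup>2 + \<eta>\<^sup>2)" for s
  proof -
    have "of_real s \<noteq> w0"
      using w0(1) by auto
    moreover have "(of_real s)\<^sup>2 + complex_of_real (\<eta>\<^sup>2) = of_real (s\<^sup>2 + \<eta>\<^sup>2)"
      by simp
    ultimately show ?thesis
      using qeq by (metis Im_divide_of_real minus_complex.sel(2))
  qed
  ultimately have "integral {-R..R} (\<lambda>s. (Im (H (of_real s)) - Im (H w0)) / (s\<^sup>2 + \<eta>\<^sup>2))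
      = Im (contour_integral ?l q)"
    by (simp add: integral_unique)
  also have "\<dots> \<le> norm (contour_integral ?l q)"
    using abs_Im_le_cmod abs_le_D1 by blast
  also have "\<dots> = norm (contour_integral ?c q)"
    using sum0 by (metis add_eq_0_iff2 norm_minus_cancel)
  finally show ?thesis
    using cbound by (simp add: w0_def)
qed

text \<open>Two limits: \<open>R \<rightarrow> \<infinity>\<close> at fixed \<open>\<eta>\<close>
  removes the arc error, then \<open>\<eta> \<rightarrow> \<infinity>\<close> removes the kernel.
  Nonnegativity on the real axis allows cutting the integral down to \<open>{-N..N}\<close> and
  bounding the weight \<open>\<eta>\<^sup>2 / (s\<^sup>2 + \<eta>\<^sup>2)\<close> below by
  \<open>\<eta>\<^sup>2 / (N\<^sup>2 + \<eta>\<^sup>2)\<close>, which tends to 1.\<close>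

lemma nonneg_boundary_integral_le:
  fixes H :: "complex \<Rightarrow> complex"
  assumes cont: "continuous_on {z. 0 \<le> Im z} H" and holo: "H holomorphic_on {z. 0 < Im z}"
    and bound: "\<And>z. 0 \<le> Im z \<Longrightarrow> norm (H z) \<le> K"
    and pos: "\<And>s. 0 \<le> Im (H (of_real s))"
    and C: "0 \<le> C"
    and decay: "\<And>\<eta>. 0 < \<eta> \<Longrightarrow> \<eta> * Im (H (\<i> * of_real \<eta>)) \<le> C"
  shows "integral {-N..N} (\<lambda>s. Im (H (of_real s))) \<le> pi * C"
proof (cases "0 < N")
  case N: True
  define f where "f = (\<lambda>s. Im (H (of_real s)))"
  have fcont: "continuous_on T f" for T
    unfolding f_def
    by (intro continuous_intros continuous_on_compose2[OF cont]) auto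
  have main: "\<eta>\<^sup>2 / (N\<^sup>2 + \<eta>\<^sup>2) * integral {-N..N} f \<le> pi * C" if \<eta>: "0 < \<eta>" for \<eta>
  proof -
    define h where "h = Im (H (\<i> * of_real \<eta>))"
    have den: "s\<^sup>2 + \<eta>\<^sup>2 \<noteq> 0" for s
      using \<eta> by (simp add: sum_power2_eq_zero_iff)
    have int: "(\<lambda>s. g s / (s\<^sup>2 + \<eta>\<^sup>2)) integrable_on {a..b}"
      if "\<And>T. continuous_on T g" for a b :: real and g :: "real \<Rightarrow> real"
      using that den by (intro integrable_continuous_real continuous_intros) auto
    have est: "\<eta>\<^sup>2 * integral {-N..N} (\<lambda>s. f s / (s\<^sup>2 + \<eta>\<^sup>2)) \<le> pi * C + \<eta>\<^sup>2 * (2 * K * R * pi / (R\<^sup>2 - \<eta>\<^sup>2))"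
      if R: "max N \<eta> < R" for R
    proof -
      have "integral {-N..N} (\<lambda>s. f s / (s\<^sup>2 + \<eta>\<^sup>2)) \<le> integral {-R..R} (\<lambda>s. f s / (s\<^sup>2 + \<eta>\<^sup>2))"
        using R N pos by (intro integral_subset_le int fcont) (auto simp: f_def)
      also have "\<dots> = integral {-R..R} (\<lambda>s. (f s - h) / (s\<^sup>2 + \<eta>\<^sup>2)) + h * integral {-R..R} (\<lambda>s. 1 / (s\<^sup>2 + \<eta>\<^sup>2))"
        using integral_diff[OF int[OF fcont] int[of "\<lambda>_. h"]] by (simp add: diff_divide_distrib flip: integral_mult_right)
      finally have 1: "integral {-N..N} (\<lambda>s. f s / (s\<^sup>2 + \<eta>\<^sup>2))
         \<le> 2 * K * R * pi / (R\<^sup>2 - \<eta>\<^sup>2) + h * integral {-R..R} (\<lambda>s. 1 / (s\<^sup>2 + \<eta>\<^sup>2))"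
        using upper_half_plane_poisson_bound[OF cont holo bound \<eta>, of R] R by (simp add: f_def h_def)
      have J: "0 \<le> integral {-R..R} (\<lambda>s. 1 / (s\<^sup>2 + \<eta>\<^sup>2))"
        by (intro integral_nonneg int) auto
      \<comment> \<open>One factor \<open>\<eta>\<close> goes to \<open>h\<close>, where
        \<open>decay\<close> applies, the other to the integral, which is at most
        \<open>pi / \<eta>\<close>.\<close>
      have "\<eta>\<^sup>2 * (h * integral {-R..R} (\<lambda>s. 1 / (s\<^sup>2 + \<eta>\<^sup>2))) = (\<eta> * h) * (\<eta> * integral {-R..R} (\<lambda>s. 1 / (s\<^sup>2 + \<eta>\<^sup>2)))"
        by (simp add: power2_eq_square)
      also have "\<dots> \<le> C * (\<eta> * integral {-R..R} (\<lambda>s. 1 / (s\<^sup>2 + \<eta>\<^sup>2)))"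
        using decay[OF \<eta>] J \<eta> by (intro mult_right_mono) (auto simp: h_def)
      also have "\<dots> \<le> C * pi"
        using integral_inverse_square_le[of R \<eta>] R N \<eta> C by (intro mult_left_mono) (auto simp: field_simps)
      finally show ?thesis
        using mult_left_mono[OF 1, of "\<eta>\<^sup>2"] by (simp add: algebra_simps)
    qed
    have "((\<lambda>R. pi * C + \<eta>\<^sup>2 * (2 * K * R * pi / (R\<^sup>2 - \<eta>\<^sup>2))) \<longlongrightarrow> pi * C) at_top"
      by real_asymp
    then have lim: "\<eta>\<^sup>2 * integral {-N..N} (\<lambda>s. f s / (s\<^sup>2 + \<eta>\<^sup>2)) \<le> pi * C"
      using est by (rule tendsto_lowerbound[OF _ eventually_mono[OF eventually_gt_at_top[of "max N \<eta>"]]]) auto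
    have "integral {-N..N} (\<lambda>s. \<eta>\<^sup>2 / (N\<^sup>2 + \<eta>\<^sup>2) * f s) \<le> integral {-N..N} (\<lambda>s. \<eta>\<^sup>2 * (f s / (s\<^sup>2 + \<eta>\<^sup>2)))"
    proof (rule integral_le)
      show "(\<lambda>s. \<eta>\<^sup>2 / (N\<^sup>2 + \<eta>\<^sup>2) * f s) integrable_on {-N..N}"
        by (intro integrable_continuous_real continuous_intros fcont)
      show "(\<lambda>s. \<eta>\<^sup>2 * (f s / (s\<^sup>2 + \<eta>\<^sup>2))) integrable_on {-N..N}"
        by (intro integrable_on_mult_right int fcont)
      fix s assume "s \<in> {-N..N}"
      then have "s\<^sup>2 \<le> N\<^sup>2"
        by (intro power2_le_iff_abs_le[THEN iffD2]) auto
      then have "\<eta>\<^sup>2 * f s / (N\<^sup>2 + \<eta>\<^sup>2) \<le> \<eta>\<^sup>2 * f s / (s\<^sup>2 + \<eta>\<^sup>2)"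
        using pos[of s] \<eta> by (intro divide_left_mono) (auto simp: f_def add_nonneg_pos)
      then show "\<eta>\<^sup>2 / (N\<^sup>2 + \<eta>\<^sup>2) * f s \<le> \<eta>\<^sup>2 * (f s / (s\<^sup>2 + \<eta>\<^sup>2))"
        by simp
    qed
    with lim show ?thesis
      unfolding integral_mult_right by linarith
  qed
  have "((\<lambda>\<eta>. \<eta>\<^sup>2 / (N\<^sup>2 + \<eta>\<^sup>2) * integral {-N..N} f) \<longlongrightarrow> 1 * integral {-N..N} f) at_top"
    by (intro tendsto_intros) real_asymp
  then have "1 * integral {-N..N} f \<le> pi * C"
    using main by (rule tendsto_upperbound[OF _ eventually_mono[OF eventually_gt_at_top]]) auto
  then show ?thesis
    by (simp add: f_def)
next
  \<comment> \<open>The interval is empty or a single point, so the integral is 0.\<close>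
  case False
  then show ?thesis
    using C by (cases "N = 0") auto
qed

section \<open>Suprema and integrals over unit intervals\<close>

lemma le_integral_unit_interval:
  fixes f f' :: "real \<Rightarrow> real"
  assumes deriv: "\<And>s. (f has_real_derivative f' s) (at s)"
    and log_lip: "\<And>s. \<bar>f' s\<bar> \<le> b * f s" and nonneg: "\<And>s. 0 \<le> f s" and b: "0 \<le> b"
    and y: "y \<in> {c..c + 1}"
  shows "f y \<le> (1 + b) * integral {c..c + 1} f"
proof -
  have cont: "continuous_on T f" for T
    using deriv by (meson DERIV_isCont continuous_at_imp_continuous_on)
  have int: "f integrable_on {p..q}" for p q
    by (intro integrable_continuous_real cont)
  \<comment> \<open>\<open>f y\<close> is compared with the minimum \<open>f t\<close>: the interval
    has length 1, so the minimum is at most the integral, and between \<open>t\<close> and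
    \<open>y\<close> the function changes by at most the integral of
    \<open>\<bar>f'\<bar> \<le> b * f\<close>.\<close>
  obtain t where t: "t \<in> {c..c + 1}" "\<And>s. s \<in> {c..c + 1} \<Longrightarrow> f t \<le> f s"
    using continuous_attains_inf[of "{c..c + 1}" f] cont by auto
  have "integral {c..c + 1} (\<lambda>_. f t) \<le> integral {c..c + 1} f"
    using t(2) by (intro integral_le int integrable_const_ivl) auto
  then have ft: "f t \<le> integral {c..c + 1} f"
    by simp
  have step: "\<bar>f q - f p\<bar> \<le> b * integral {c..c + 1} f" if pq: "c \<le> p" "p \<le> q" "q \<le> c + 1" for p q
  proof -
    have ftc: "(f' has_integral f q - f p) {p..q}"
      using pq deriv by (intro fundamental_theorem_of_calculus)
        (auto simp: has_real_derivative_iff_has_vector_derivative[symmetric] intro: has_field_derivative_at_within)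
    then have "\<bar>f q - f p\<bar> = norm (integral {p..q} f')"
      by (simp add: integral_unique)
    also have "\<dots> \<le> integral {p..q} (\<lambda>s. b * f s)"
      using ftc log_lip by (intro integral_norm_bound_integral integrable_on_mult_right int) auto
    also have "\<dots> = b * integral {p..q} f"
      by simp
    also have "\<dots> \<le> b * integral {c..c + 1} f"
      using pq nonneg b by (intro mult_left_mono integral_subset_le int) auto
    finally show ?thesis .
  qed
  have "f y - f t \<le> b * integral {c..c + 1} f"
    using step[of t y] step[of y t] t(1) y by (cases "t \<le> y") auto
  with ft show ?thesis
    by (simp add: algebra_simps)
qed

lemma sum_integrals_unit_intervals_le:
  fixes f :: "real \<Rightarrow> real"
  assumes cont: "continuous_on UNIV f" and nonneg: "\<And>s. 0 \<le> f s"
    and bound: "\<And>N. integral {-N..N} f \<le> C" and fin: "finite F"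
  shows "(\<Sum>n\<in>F. integral {of_int n..of_int n + 1} f) \<le> C"
proof -
  have int: "f integrable_on {p..q}" for p q
    by (intro integrable_continuous_real continuous_on_subset[OF cont]) auto
  \<comment> \<open>Inserting 0 keeps \<open>Max\<close> defined for empty \<open>F\<close>; adding
    1 makes \<open>\<bar>n\<bar> < N\<close>, so that the whole interval from \<open>n\<close> to
    \<open>n + 1\<close> lies in \<open>{-N..N}\<close>.\<close>
  define M where "M = Max (insert 0 (abs ` F)) + 1"
  have M: "\<bar>n\<bar> < M" if "n \<in> F" for n
    using Max_ge[of "insert 0 (abs ` F)" "\<bar>n\<bar>"] that fin by (simp add: M_def)
  define N where "N = nat M"
  let ?g = "\<lambda>n::int. integral {of_int n..of_int n + 1} f"
  have tele: "(\<Sum>k<m. integral {real k - real N..real k - real N + 1} f) = integral {- real N..real m - real N} f" for m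
  proof (induction m)
    case (Suc m)
    then show ?case
      using Henstock_Kurzweil_Integration.integral_combine[of "- real N" "real m - real N" "real (Suc m) - real N" f] int
      by (simp add: algebra_simps)
  qed simp
  have "F \<subseteq> (\<lambda>k. int k - int N) ` {..<2 * N}"
  proof
    fix n assume "n \<in> F"
    then show "n \<in> (\<lambda>k. int k - int N) ` {..<2 * N}"
      using M[of n] by (intro image_eqI[of _ _ "nat (n + int N)"]) (auto simp: N_def)
  qed
  then have "(\<Sum>n\<in>F. ?g n) \<le> (\<Sum>n\<in>(\<lambda>k. int k - int N) ` {..<2 * N}. ?g n)"
    using nonneg by (intro sum_mono2 integral_nonneg int) auto
  also have "\<dots> = (\<Sum>k<2 * N. ?g (int k - int N))"
    by (subst sum.reindex) (auto simp: inj_on_def)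
  also have "\<dots> = integral {- real N..real N} f"
    using tele[of "2 * N"] by simp
  finally show ?thesis
    using bound[of "real N"] by linarith
qed

section \<open>Orthogonal projection and the range of a self-adjoint operator\<close>

lemma closed_subspace_orthogonal_vector:
  fixes S :: "'a::{real_inner, complete_space} set"
  assumes sub: "subspace S" and clo: "closed S" and p: "p \<notin> S"
  obtains z where "z \<noteq> 0" "\<And>x. x \<in> S \<Longrightarrow> inner x z = 0"
proof -
  have ne: "S \<noteq> {}"
    using subspace_0[OF sub] by blast
  \<comment> \<open>The vector sought is \<open>p - q\<close>, where \<open>q\<close> is the point
    of \<open>S\<close> nearest to \<open>p\<close>, obtained as the limit of a minimizing
    sequence.\<close>
  define d where "d = infdist p S"
  have d0: "0 \<le> d"
    unfolding d_def by (rule infdist_nonneg)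
  have le: "d \<le> norm (p - x)" if "x \<in> S" for x
    using infdist_le[OF that, of p] by (simp add: d_def dist_norm)
  have "\<exists>x\<in>S. norm (p - x) < d + e" if "0 < e" for e
    using cInf_lessD[of "dist p ` S" "d + e"] that ne by (auto simp: d_def infdist_def dist_norm)
  then have "\<forall>n. \<exists>x\<in>S. norm (p - x) < d + 1 / real (Suc n)"
    by simp
  then obtain X where X: "\<And>n. X n \<in> S" "\<And>n. norm (p - X n) < d + 1 / real (Suc n)"
    by metis
  have lim: "(\<lambda>n. norm (p - X n)) \<longlonglongrightarrow> d"
  proof (rule tendsto_sandwich[of "\<lambda>_. d" _ _ "\<lambda>n. d + 1 / real (Suc n)"])
    show "(\<lambda>n. d + 1 / real (Suc n)) \<longlonglongrightarrow> d"
      using tendsto_add[OF tendsto_const[of d] lim_1_over_n[THEN LIMSEQ_Suc]] by simp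
    show "\<forall>\<^sub>F n in sequentially. norm (p - X n) \<le> d + 1 / real (Suc n)"
      using X(2) by (intro always_eventually allI less_imp_le)
  qed (use X(1) le in auto)
  \<comment> \<open>Parallelogram law for \<open>p - X m\<close> and \<open>p - X n\<close>: their
    midpoint is \<open>p\<close> minus a point of \<open>S\<close>, so its norm is at least
    \<open>d\<close>.\<close>
  have gap: "(norm (X m - X n))\<^sup>2 \<le> 2 * (norm (p - X m))\<^sup>2 + 2 * (norm (p - X n))\<^sup>2 - 4 * d\<^sup>2" for m n
  proof -
    have "(1/2) *\<^sub>R (X m + X n) \<in> S"
      by (intro subspace_scale[OF sub] subspace_add[OF sub] X)
    from power_mono[OF le[OF this] d0, of 2]
    have "d\<^sup>2 \<le> (norm (p - (1/2) *\<^sub>R (X m + X n)))\<^sup>2" .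
    then show ?thesis
      by (simp add: power2_norm_eq_inner inner_diff_left inner_diff_right inner_add_left inner_add_right
          inner_commute[of "X n" "X m"] inner_commute[of "X n" p] inner_commute[of "X m" p] field_simps)
  qed
  have "Cauchy X"
  proof (rule metric_CauchyI)
    fix e :: real assume e: "0 < e"
    have "(\<lambda>n. (norm (p - X n))\<^sup>2) \<longlonglongrightarrow> d\<^sup>2"
      by (intro tendsto_intros lim)
    moreover have "d\<^sup>2 < d\<^sup>2 + e\<^sup>2 / 4"
      using e by simp
    ultimately obtain N where N: "\<And>n. n \<ge> N \<Longrightarrow> (norm (p - X n))\<^sup>2 < d\<^sup>2 + e\<^sup>2 / 4"
      by (metis (no_types, lifting) order_tendstoD(2) eventually_sequentially)
    have "dist (X m) (X n) < e" if "m \<ge> N" "n \<ge> N" for m n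
    proof -
      have "(norm (X m - X n))\<^sup>2 < e\<^sup>2"
        using gap[of m n] N[OF that(1)] N[OF that(2)] by linarith
      then show ?thesis
        using e by (simp add: dist_norm power2_less_imp_less)
    qed
    then show "\<exists>M. \<forall>m\<ge>M. \<forall>n\<ge>M. dist (X m) (X n) < e"
      by blast
  qed
  then obtain q where q: "X \<longlonglongrightarrow> q"
    using Cauchy_convergent convergent_def by blast
  have qS: "q \<in> S"
    using closed_sequentially[OF clo _ q] X by blast
  have "(\<lambda>n. norm (p - X n)) \<longlonglongrightarrow> norm (p - q)"
    by (intro tendsto_intros q)
  then have nq: "norm (p - q) = d"
    using LIMSEQ_unique lim by blast
  have "inner x (p - q) = 0" if x: "x \<in> S" for x
  proof (cases "x = 0")
    case False
    \<comment> \<open>The coefficient minimizing \<open>norm ((p - q) - c *\<^sub>R x)\<close>.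
      Since \<open>q\<close> is already nearest, the gain
      \<open>(inner x (p - q))\<^sup>2 / inner x x\<close> must vanish.\<close>
    define c where "c = inner x (p - q) / inner x x"
    have "q + c *\<^sub>R x \<in> S"
      by (intro subspace_add[OF sub] subspace_scale[OF sub] qS x)
    from power_mono[OF le[OF this] d0, of 2]
    have "(norm (p - q))\<^sup>2 \<le> (norm ((p - q) - c *\<^sub>R x))\<^sup>2"
      by (simp add: nq diff_diff_eq)
    then have "2 * c * inner x (p - q) \<le> c\<^sup>2 * inner x x"
      unfolding power2_norm_eq_inner
      by (simp add: inner_diff_left inner_diff_right inner_commute
          power2_eq_square algebra_simps)
    moreover have "c * inner x x = inner x (p - q)"
      using False by (simp add: c_def)
    ultimately have "c * inner x (p - q) \<le> 0"
      by (simp add: power2_eq_square mult.assoc)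
    then have "(inner x (p - q))\<^sup>2 / inner x x \<le> 0"
      by (simp add: c_def power2_eq_square)
    moreover have "0 < inner x x"
      using False by simp
    ultimately show ?thesis
      by (simp add: divide_le_0_iff)
  qed auto
  moreover have "p - q \<noteq> 0"
    using qS p by auto
  ultimately show thesis
    using that by blast
qed

lemma self_adjoint_op_add:
  "self_adjoint_op D A \<Longrightarrow> x \<in> D \<Longrightarrow> y \<in> D \<Longrightarrow> A (x + y) = A x + A y"
  by (simp add: self_adjoint_op_def)

lemma self_adjoint_op_scaleR:
  "self_adjoint_op D A \<Longrightarrow> x \<in> D \<Longrightarrow> A (c *\<^sub>R x) = c *\<^sub>R A x"
  by (simp add: self_adjoint_op_def)

lemma self_adjoint_op_subspace: "self_adjoint_op D A \<Longrightarrow> subspace D"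
  by (simp add: self_adjoint_op_def)

lemma self_adjoint_op_diff:
  assumes "self_adjoint_op D A" "x \<in> D" "y \<in> D"
  shows "A (x - y) = A x - A y"
  using self_adjoint_op_add[OF assms(1), of x "- y"] self_adjoint_op_scaleR[OF assms(1), of y "- 1"]
    subspace_neg[OF self_adjoint_op_subspace[OF assms(1)]] assms by simp

lemma self_adjoint_op_symmetric:
  "self_adjoint_op D A \<Longrightarrow> x \<in> D \<Longrightarrow> y \<in> D \<Longrightarrow> inner (A x) y = inner x (A y)"
  by (simp add: self_adjoint_op_def)

text \<open>Membership in \<open>D\<close> is the adjoint clause of self-adjointness. For the value,
  \<open>A y - z\<close> is orthogonal to the dense set \<open>D\<close>, hence to itself.\<close>

lemma self_adjoint_op_adjoint:
  assumes sa: "self_adjoint_op D A" and adj: "\<And>x. x \<in> D \<Longrightarrow> inner (A x) y = inner x z"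
  shows "y \<in> D" "A y = z"
proof -
  show yD: "y \<in> D"
    using assms unfolding self_adjoint_op_def by blast
  have orth: "inner x (A y - z) = 0" if "x \<in> D" for x
    using adj[OF that] self_adjoint_op_symmetric[OF sa that yD] by (simp add: inner_diff_right)
  have "closed {x. inner x (A y - z) = 0}"
    by (intro closed_Collect_eq continuous_intros)
  then have "closure D \<subseteq> {x. inner x (A y - z) = 0}"
    using orth by (intro closure_minimal) auto
  then have "inner (A y - z) (A y - z) = 0"
    using sa unfolding self_adjoint_op_def by blast
  then show "A y = z"
    by simp
qed

text \<open>The lower bound makes the range closed: preimages of a convergent sequence are Cauchy,
  and \<open>A\<close> is a closed operator. A vector orthogonal to the range lies in the kernel of
  the adjoint, which is \<open>A\<close> itself, so the lower bound makes it 0.\<close>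

lemma self_adjoint_op_surj:
  fixes A :: "'a::{real_inner, complete_space} \<Rightarrow> 'a"
  assumes sa: "self_adjoint_op D A" and bound: "\<And>x. x \<in> D \<Longrightarrow> norm x \<le> norm (A x)"
  shows "A ` D = UNIV"
proof (rule ccontr)
  assume "A ` D \<noteq> UNIV"
  then obtain p where p: "p \<notin> A ` D"
    by blast
  note subD = self_adjoint_op_subspace[OF sa]
  have sub: "subspace (A ` D)"
    unfolding subspace_def
  proof (intro conjI ballI allI)
    show "0 \<in> A ` D"
      using self_adjoint_op_scaleR[OF sa, of 0 0] subspace_0[OF subD] by force
    show "x + y \<in> A ` D" if "x \<in> A ` D" "y \<in> A ` D" for x y
      using that self_adjoint_op_add[OF sa] subspace_add[OF subD]
      by (auto simp: image_iff) metis
    show "c *\<^sub>R x \<in> A ` D" if "x \<in> A ` D" for c x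
      using that self_adjoint_op_scaleR[OF sa] subspace_scale[OF subD]
      by (auto simp: image_iff) metis
  qed
  have clo: "closed (A ` D)"
    unfolding closed_sequential_limits
  proof (intro allI impI, elim conjE)
    fix Y y assume Y: "\<forall>n. Y n \<in> A ` D" and lim: "Y \<longlonglongrightarrow> y"
    then obtain X where X: "\<And>n. X n \<in> D" "\<And>n. Y n = A (X n)"
      unfolding image_iff by metis
    have "dist (X m) (X n) \<le> dist (Y m) (Y n)" for m n
      using bound[of "X m - X n"] X subspace_diff[OF subD]
      by (simp add: dist_norm self_adjoint_op_diff[OF sa])
    moreover have "Cauchy Y"
      using lim by (rule LIMSEQ_imp_Cauchy)
    ultimately have "Cauchy X"
      unfolding Cauchy_def by (meson le_less_trans)
    then obtain x where x: "X \<longlonglongrightarrow> x"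
      using Cauchy_convergent convergent_def by blast
    \<comment> \<open>Symmetry passes to the limit, and self-adjointness turns the resulting
      identity into \<open>x \<in> D\<close> and \<open>A x = y\<close>.\<close>
    have "inner (A w) x = inner w y" if w: "w \<in> D" for w
    proof (rule LIMSEQ_unique)
      show "(\<lambda>n. inner (A w) (X n)) \<longlonglongrightarrow> inner (A w) x"
        by (intro tendsto_intros x)
      show "(\<lambda>n. inner (A w) (X n)) \<longlonglongrightarrow> inner w y"
        using self_adjoint_op_symmetric[OF sa w X(1)] tendsto_inner[OF tendsto_const[of w] lim]
        by (simp add: X(2))
    qed
    from self_adjoint_op_adjoint[OF sa this] show "y \<in> A ` D"
      by blast
  qed
  obtain z where z: "z \<noteq> 0" "\<And>x. x \<in> A ` D \<Longrightarrow> inner x z = 0"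
    using closed_subspace_orthogonal_vector[OF sub clo p] by blast
  have "z \<in> D" "A z = 0"
    using self_adjoint_op_adjoint[OF sa, of z 0] z(2) by auto
  then show False
    using bound[of z] z(1) by simp
qed

section \<open>The operator \<open>A + z B + \<i>\<close> on pairs and its inverse\<close>

lemma norm_rotate:
  fixes p q :: "'a::real_inner"
  shows "norm (a *\<^sub>R p + b *\<^sub>R q, b *\<^sub>R p - a *\<^sub>R q)
    = sqrt (a\<^sup>2 + b\<^sup>2) * sqrt ((norm p)\<^sup>2 + (norm q)\<^sup>2)"
  unfolding norm_prod_def real_sqrt_mult[symmetric] power2_norm_eq_inner
  by (simp add: inner_add_left inner_add_right inner_diff_left inner_diff_right
      inner_commute[of q p] power2_eq_square algebra_simps)

locale perturbation =
  fixes A B :: "'a::{real_inner, complete_space} \<Rightarrow> 'a" and D :: "'a set"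
  assumes self_adjoint: "self_adjoint_op D A"
    and bounded: "bounded_linear B"
    and symmetric: "inner (B x) y = inner x (B y)"
    and nonneg: "0 \<le> inner (B x) x"
begin

lemmas B_simps = bounded_linear.linear[OF bounded, THEN linear_add]
  bounded_linear.linear[OF bounded, THEN linear_diff]
  bounded_linear.linear[OF bounded, THEN linear_scale]

lemma norm_B_le: "norm (B x) \<le> onorm B * norm x"
  using onorm[OF bounded] .

lemma onorm_nonneg: "0 \<le> onorm B"
  using onorm_pos_le[OF bounded] .

text \<open>Discriminant argument: the form at \<open>t *\<^sub>R x + y\<close> is a nonnegative
  quadratic in \<open>t\<close>, and a violation would make it negative somewhere. The form may be
  degenerate, hence the separate case of a vanishing leading coefficient.\<close>

lemma cauchy_schwarz_form: "(inner (B x) y)\<^sup>2 \<le> inner (B x) x * inner (B y) y"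
proof -
  have "0 \<le> inner (B x) x * t\<^sup>2 + 2 * inner (B x) y * t + inner (B y) y" for t :: real
    using nonneg[of "t *\<^sub>R x + y"] symmetric[of y x]
    by (simp add: B_simps inner_add_left inner_add_right power2_eq_square algebra_simps inner_commute)
  moreover have "\<exists>t::real. inner (B x) x * t\<^sup>2 + 2 * inner (B x) y * t + inner (B y) y < 0"
    if lt: "inner (B x) x * inner (B y) y < (inner (B x) y)\<^sup>2"
  proof (cases "inner (B x) x = 0")
    case True
    then have "inner (B x) y \<noteq> 0"
      using lt by auto
    \<comment> \<open>This \<open>t\<close> makes the remaining affine function equal to -1.\<close>
    then have "2 * inner (B x) y * (- (inner (B y) y + 1) / (2 * inner (B x) y)) + inner (B y) y < 0"
      by (simp add: field_simps)
    then show ?thesis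
      unfolding True mult_zero_left add_0 by (rule exI)
  next
    case False
    then have pos: "0 < inner (B x) x"
      using nonneg[of x] by simp
    \<comment> \<open>The vertex of the parabola.\<close>
    let ?t = "- inner (B x) y / inner (B x) x"
    have "inner (B x) x * ?t\<^sup>2 + 2 * inner (B x) y * ?t + inner (B y) y
        = (inner (B x) x * inner (B y) y - (inner (B x) y)\<^sup>2) / inner (B x) x"
      using pos by (simp add: field_simps power2_eq_square)
    also have "\<dots> < 0"
      using lt pos by (simp add: divide_neg_pos)
    finally show ?thesis
      by blast
  qed
  ultimately show ?thesis
    by (meson not_le)
qed

text \<open>The space is real, so \<open>R(z) \<psi>\<close> is represented by the pair \<open>x = (v, u)\<close> with
  \<open>R(z) \<psi> = v - \<i> u\<close>. The components of \<open>dilation z x\<close> are the real and imaginary part of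
  \<open>(A + z B + \<i>) (v - \<i> u)\<close>; with this sign convention the operator is self-adjoint.\<close>

definition dilation :: "complex \<Rightarrow> 'a \<times> 'a \<Rightarrow> 'a \<times> 'a" where
  "dilation z x = (A (fst x) + Re z *\<^sub>R B (fst x) + snd x + Im z *\<^sub>R B (snd x),
                   fst x + Im z *\<^sub>R B (fst x) - A (snd x) - Re z *\<^sub>R B (snd x))"

text \<open>As a block matrix, \<open>dilation z\<close> has \<open>A + Re z B\<close> and its
  negative on the diagonal and \<open>1 + Im z B\<close> in the other two corners: a bounded
  symmetric perturbation of \<open>A\<close> and \<open>- A\<close>. Testing against
  \<open>(x, 0)\<close> and \<open>(0, x)\<close> and moving the bounded terms to the other side
  leaves the adjoint condition for \<open>A\<close> in each component.\<close>

lemma self_adjoint_dilation: "self_adjoint_op (D \<times> D) (dilation z)"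
  unfolding self_adjoint_op_def
proof (intro conjI ballI allI impI)
  note subD = self_adjoint_op_subspace[OF self_adjoint]
  show "subspace (D \<times> D)"
    by (rule subspace_Times[OF subD subD])
  show "closure (D \<times> D) = UNIV"
    using self_adjoint by (simp add: closure_Times self_adjoint_op_def)
  show "dilation z (x + y) = dilation z x + dilation z y" if "x \<in> D \<times> D" "y \<in> D \<times> D" for x y
    using that by (auto simp: dilation_def mem_Times_iff self_adjoint_op_add[OF self_adjoint] B_simps algebra_simps)
  show "dilation z (c *\<^sub>R x) = c *\<^sub>R dilation z x" if "x \<in> D \<times> D" for x c
    using that by (auto simp: dilation_def mem_Times_iff self_adjoint_op_scaleR[OF self_adjoint] B_simps algebra_simps)
  show "inner (dilation z x) y = inner x (dilation z y)" if "x \<in> D \<times> D" "y \<in> D \<times> D" for x y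
    using that
    by (auto simp: dilation_def inner_prod_def mem_Times_iff inner_add_left inner_add_right inner_diff_left
        inner_diff_right symmetric self_adjoint_op_symmetric[OF self_adjoint])
  show "y \<in> D \<times> D" if adj: "\<forall>x\<in>D \<times> D. inner (dilation z x) y = inner x w" for y w
  proof -
    have A0: "A 0 = 0"
      using self_adjoint_op_scaleR[OF self_adjoint subspace_0[OF subD], of 0] by simp
    have B0: "B 0 = 0"
      using linear_0[OF bounded_linear.linear[OF bounded]] .
    have "inner (A x) (fst y) = inner x (fst w - Re z *\<^sub>R B (fst y) - snd y - Im z *\<^sub>R B (snd y))"
      if "x \<in> D" for x
      using adj[rule_format, of "(x, 0)"] that subspace_0[OF subD]
      by (simp add: dilation_def inner_prod_def A0 B0 inner_add_left inner_add_right inner_diff_left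
        inner_diff_right symmetric)
    then have "fst y \<in> D"
      using self_adjoint_op_adjoint[OF self_adjoint] by blast
    moreover have "inner (A x) (snd y) = inner x (fst y + Im z *\<^sub>R B (fst y) - Re z *\<^sub>R B (snd y) - snd w)"
      if "x \<in> D" for x
      using adj[rule_format, of "(0, x)"] that subspace_0[OF subD]
      by (simp add: dilation_def inner_prod_def A0 B0 inner_add_left inner_add_right inner_diff_left
        inner_diff_right symmetric)
    then have "snd y \<in> D"
      using self_adjoint_op_adjoint[OF self_adjoint] by blast
    ultimately show ?thesis
      by (simp add: mem_Times_iff)
  qed
qed

text \<open>The swapped pair picks out the imaginary part of
  \<open>\<langle>(A + z B + \<i>) r, r\<rangle>\<close> for \<open>r = v - \<i> u\<close>; the
  contributions of \<open>A\<close> and \<open>Re z B\<close> cancel by symmetry. Both the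
  coercivity of \<open>dilation z\<close> and the formula for \<open>Im (herglotz \<psi> z)\<close>
  come from this.\<close>

lemma dilation_energy:
  assumes "x \<in> D \<times> D"
  shows "inner (dilation z x) (snd x, fst x)
    = (norm x)\<^sup>2 + Im z * (inner (B (fst x)) (fst x) + inner (B (snd x)) (snd x))"
proof -
  have "inner (A (fst x)) (snd x) = inner (A (snd x)) (fst x)"
    using self_adjoint_op_symmetric[OF self_adjoint, of "fst x" "snd x"] assms
    by (simp add: mem_Times_iff inner_commute)
  moreover have "inner (B (fst x)) (snd x) = inner (B (snd x)) (fst x)"
    using symmetric by (metis inner_commute)
  ultimately show ?thesis
    by (simp add: dilation_def inner_prod_def inner_add_left inner_diff_left power2_norm_eq_inner
        algebra_simps)
qed

lemma norm_le_dilation: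
  assumes x: "x \<in> D \<times> D" and z: "0 \<le> Im z"
  shows "norm x \<le> norm (dilation z x)"
proof (cases "x = 0")
  case False
  have "(norm x)\<^sup>2 \<le> inner (dilation z x) (snd x, fst x)"
    using dilation_energy[OF x, of z] z nonneg by (simp add: add_nonneg_nonneg)
  also have "\<dots> \<le> norm (dilation z x) * norm (snd x, fst x)"
    by (rule norm_cauchy_schwarz)
  also have "norm (snd x, fst x) = norm x"
    by (simp add: norm_prod_def add.commute)
  finally show ?thesis
    using False by (simp add: power2_eq_square)
qed simp

text \<open>Encodes \<open>R(z) \<psi>\<close>. For \<open>Im z \<ge> 0\<close>,
  \<open>norm_le_dilation\<close> yields existence through \<open>self_adjoint_op_surj\<close> and
  also uniqueness, so the choice is harmless.\<close>

definition solution :: "complex \<Rightarrow> 'a \<Rightarrow> 'a \<times> 'a" where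
  "solution z \<psi> = (SOME x. x \<in> D \<times> D \<and> dilation z x = (\<psi>, 0))"

lemma solution:
  assumes "0 \<le> Im z"
  shows "solution z \<psi> \<in> D \<times> D" "dilation z (solution z \<psi>) = (\<psi>, 0)"
proof -
  have "(\<psi>, 0) \<in> dilation z ` (D \<times> D)"
    using self_adjoint_op_surj[OF self_adjoint_dilation] norm_le_dilation[OF _ assms] by blast
  then have "\<exists>x. x \<in> D \<times> D \<and> dilation z x = (\<psi>, 0)"
    by (metis imageE)
  from someI_ex[OF this] show "solution z \<psi> \<in> D \<times> D" "dilation z (solution z \<psi>) = (\<psi>, 0)"
    by (auto simp: solution_def)
qed

lemma norm_solution_le:
  assumes "0 \<le> Im z"
  shows "norm (solution z \<psi>) \<le> norm \<psi>"
  using norm_le_dilation[OF solution(1)[OF assms] assms, of \<psi>] solution(2)[OF assms, of \<psi>]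
  by simp

text \<open>Both solutions have the image \<open>(\<psi>, 0)\<close>, so \<open>dilation z\<close>
  of their difference equals the difference of the two operators at one solution. There the
  unbounded part cancels and only \<open>B\<close> remains.\<close>

lemma solution_lipschitz:
  assumes z: "0 \<le> Im z" and w: "0 \<le> Im w"
  shows "norm (solution z \<psi> - solution w \<psi>) \<le> norm (z - w) * (onorm B * norm \<psi>)"
proof -
  let ?x = "solution z \<psi>" and ?y = "solution w \<psi>"
  have inD: "?x - ?y \<in> D \<times> D"
    using subspace_diff[OF self_adjoint_op_subspace[OF self_adjoint_dilation]] solution z w by blast
  have "norm (?x - ?y) \<le> norm (dilation z (?x - ?y))"
    by (rule norm_le_dilation[OF inD z])
  also have "dilation z (?x - ?y) = dilation w ?y - dilation z ?y"
    using self_adjoint_op_diff[OF self_adjoint_dilation] solution z w by metis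
  also have "\<dots> = (Re (w - z) *\<^sub>R B (fst ?y) + Im (w - z) *\<^sub>R B (snd ?y),
                    Im (w - z) *\<^sub>R B (fst ?y) - Re (w - z) *\<^sub>R B (snd ?y))"
    by (simp add: dilation_def algebra_simps)
  \<comment> \<open>The coefficients form a reflection scaled by \<open>norm (w - z)\<close>, so no
    constant is lost.\<close>
  also have "norm \<dots> = norm (z - w) * sqrt ((norm (B (fst ?y)))\<^sup>2 + (norm (B (snd ?y)))\<^sup>2)"
    unfolding norm_rotate by (simp only: norm_minus_commute[of z w] cmod_def[of "w - z"])
  also have "\<dots> \<le> norm (z - w) * (onorm B * norm ?y)"
  proof (rule mult_left_mono)
    have "(norm (B (fst ?y)))\<^sup>2 + (norm (B (snd ?y)))\<^sup>2
        \<le> (onorm B * norm (fst ?y))\<^sup>2 + (onorm B * norm (snd ?y))\<^sup>2"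
      by (intro add_mono power_mono norm_B_le) auto
    also have "\<dots> = (onorm B * norm ?y)\<^sup>2"
      by (simp add: norm_prod_def power_mult_distrib algebra_simps)
    finally show "sqrt ((norm (B (fst ?y)))\<^sup>2 + (norm (B (snd ?y)))\<^sup>2) \<le> onorm B * norm ?y"
      by (intro real_le_lsqrt) (auto simp: onorm_nonneg)
  qed simp
  also have "\<dots> \<le> norm (z - w) * (onorm B * norm \<psi>)"
    by (intro mult_left_mono norm_solution_le w) (auto simp: onorm_nonneg)
  finally show ?thesis .
qed

section \<open>The Herglotz function \<open>H(z)\<close> and its boundary values\<close>

definition herglotz :: "'a \<Rightarrow> complex \<Rightarrow> complex" where
  "herglotz \<psi> z = Complex (- inner \<psi> (fst (solution z \<psi>))) (inner \<psi> (snd (solution z \<psi>)))"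

text \<open>The complex bilinear (not sesquilinear) extension of \<open>\<langle>x, B y\<rangle>\<close>, again with \<open>(v, u)\<close>
  standing for \<open>v - \<i> u\<close>.\<close>

definition pairing :: "'a \<times> 'a \<Rightarrow> 'a \<times> 'a \<Rightarrow> complex" where
  "pairing x y = Complex (inner (fst x) (B (fst y)) - inner (snd x) (B (snd y)))
                         (- (inner (fst x) (B (snd y)) + inner (snd x) (B (fst y))))"

text \<open>On the real axis only the squared norm survives, the source of nonnegativity and of the
  derivative bound; on the imaginary axis the \<open>B\<close> term yields the decay.\<close>

lemma Im_herglotz_energy:
  assumes "0 \<le> Im z"
  shows "Im (herglotz \<psi> z) = (norm (solution z \<psi>))\<^sup>2
    + Im z * (inner (B (fst (solution z \<psi>))) (fst (solution z \<psi>)) + inner (B (snd (solution z \<psi>))) (snd (solution z \<psi>)))"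
  using dilation_energy[OF solution(1)[OF assms], of z \<psi>]
  by (simp add: solution(2)[OF assms] herglotz_def inner_prod_def)

lemma norm_herglotz_le:
  assumes "0 \<le> Im z"
  shows "norm (herglotz \<psi> z) \<le> (norm \<psi>)\<^sup>2"
proof -
  let ?x = "solution z \<psi>"
  have "(inner \<psi> (fst ?x))\<^sup>2 + (inner \<psi> (snd ?x))\<^sup>2 \<le> (norm \<psi> * norm (fst ?x))\<^sup>2 + (norm \<psi> * norm (snd ?x))\<^sup>2"
    by (intro add_mono abs_le_square_iff[THEN iffD1]) (simp_all add: Cauchy_Schwarz_ineq2)
  also have "\<dots> = (norm \<psi>)\<^sup>2 * (norm ?x)\<^sup>2"
    by (simp add: norm_prod_def power_mult_distrib algebra_simps)
  also have "\<dots> \<le> (norm \<psi>)\<^sup>2 * (norm \<psi>)\<^sup>2"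
    by (intro mult_left_mono power_mono norm_solution_le assms) auto
  finally show ?thesis
    by (simp add: herglotz_def cmod_def real_le_lsqrt power2_eq_square)
qed

text \<open>The resolvent identity \<open>R(z) - R(w) = - (z - w) R(w) B R(z)\<close> placed between
  two copies of \<open>\<psi>\<close>, with \<open>R(w)\<close> moved to the left factor; it is
  symmetric for the bilinear pairing. The proof works in real components.\<close>

lemma herglotz_diff:
  assumes z: "0 \<le> Im z" and w: "0 \<le> Im w"
  shows "herglotz \<psi> z - herglotz \<psi> w = (z - w) * pairing (solution w \<psi>) (solution z \<psi>)"
proof -
  obtain v u where x: "solution z \<psi> = (v, u)"
    by fastforce
  obtain v' u' where y: "solution w \<psi> = (v', u')"
    by fastforce
  have D: "v \<in> D" "u \<in> D" "v' \<in> D" "u' \<in> D"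
    using solution(1)[OF z, of \<psi>] solution(1)[OF w, of \<psi>] x y by auto
  have eq: "\<psi> = A v + Re z *\<^sub>R B v + u + Im z *\<^sub>R B u" "A u = v + Im z *\<^sub>R B v - Re z *\<^sub>R B u"
    "\<psi> = A v' + Re w *\<^sub>R B v' + u' + Im w *\<^sub>R B u'" "A u' = v' + Im w *\<^sub>R B v' - Re w *\<^sub>R B u'"
    using solution(2)[OF z, of \<psi>] solution(2)[OF w, of \<psi>] x y
    by (auto simp: dilation_def algebra_simps)
  have ip: "inner \<psi> t = inner (A v) t + Re z * inner (B v) t + inner u t + Im z * inner (B u) t"
    "inner (A u) t = inner v t + Im z * inner (B v) t - Re z * inner (B u) t"
    "inner \<psi> t = inner (A v') t + Re w * inner (B v') t + inner u' t + Im w * inner (B u') t"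
    "inner (A u') t = inner v' t + Im w * inner (B v') t - Re w * inner (B u') t" for t
    using eq[THEN arg_cong, of "\<lambda>r. inner r t"] by (simp_all add: inner_add_left inner_diff_left)
  \<comment> \<open>All mixed inner products are brought to one orientation, so that
    \<open>algebra\<close> sees polynomial identities in real unknowns.\<close>
  have A_sym: "inner (A v') v = inner (A v) v'" "inner (A v') u = inner (A u) v'"
    "inner (A v) u' = inner (A u') v" "inner (A u') u = inner (A u) u'"
    using D self_adjoint_op_symmetric[OF self_adjoint] by (metis inner_commute)+
  have B_sym: "inner (B v') v = inner (B v) v'" "inner (B v') u = inner (B u) v'"
    "inner (B u') v = inner (B v) u'" "inner (B u') u = inner (B u) u'"
    using symmetric by (metis inner_commute)+
  have I_sym: "inner v' v = inner v v'" "inner v' u = inner u v'" "inner u' v = inner v u'" "inner u' u = inner u u'"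
    by (simp_all add: inner_commute)
  have "inner \<psi> v' - inner \<psi> v
     = (Re z - Re w) * (inner (B v) v' - inner (B u) u') + (Im z - Im w) * (inner (B u) v' + inner (B v) u')"
    using ip(1)[of v'] ip(3)[of v] ip(2)[of u'] ip(4)[of u]
    unfolding A_sym B_sym I_sym by algebra
  moreover have "inner \<psi> u - inner \<psi> u'
     = (Im z - Im w) * (inner (B v) v' - inner (B u) u') - (Re z - Re w) * (inner (B u) v' + inner (B v) u')"
    using ip(1)[of u'] ip(3)[of u] ip(2)[of v'] ip(4)[of v]
    unfolding A_sym B_sym I_sym by algebra
  ultimately show ?thesis
    by (simp add: herglotz_def pairing_def x y complex_eq_iff inner_commute algebra_simps)
qed

lemma tendsto_solution:
  assumes w: "0 \<le> Im w"
  shows "((\<lambda>z. solution z \<psi>) \<longlongrightarrow> solution w \<psi>) (at w within {z. 0 \<le> Im z})"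
proof (rule Lim_null_comparison[where g = "\<lambda>z. norm (z - w) * (onorm B * norm \<psi>)", THEN LIM_zero_cancel])
  show "\<forall>\<^sub>F z in at w within {z. 0 \<le> Im z}. norm (solution z \<psi> - solution w \<psi>) \<le> norm (z - w) * (onorm B * norm \<psi>)"
    using solution_lipschitz[OF _ w] by (auto simp: eventually_at_filter)
  have "((\<lambda>z. norm (z - w) * (onorm B * norm \<psi>)) \<longlongrightarrow> norm (w - w) * (onorm B * norm \<psi>)) (at w within {z. 0 \<le> Im z})"
    by (intro tendsto_intros)
  then show "((\<lambda>z. norm (z - w) * (onorm B * norm \<psi>)) \<longlongrightarrow> 0) (at w within {z. 0 \<le> Im z})"
    by simp
qed

lemma tendsto_pairing:
  assumes "(x \<longlongrightarrow> a) F" "(y \<longlongrightarrow> b) F"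
  shows "((\<lambda>t. pairing (x t) (y t)) \<longlongrightarrow> pairing a b) F"
  unfolding pairing_def
  by (intro tendsto_intros bounded_linear.tendsto[OF bounded] assms)

text \<open>Divide \<open>herglotz_diff\<close> by \<open>z - w\<close> and let \<open>z\<close>
  tend to \<open>w\<close>. Working relative to the closed half-plane gives holomorphy inside and
  continuity up to the real axis at once.\<close>

lemma herglotz_has_derivative:
  assumes w: "0 \<le> Im w"
  shows "(herglotz \<psi> has_field_derivative pairing (solution w \<psi>) (solution w \<psi>)) (at w within {z. 0 \<le> Im z})"
  unfolding has_field_derivative_iff
proof (rule Lim_transform_eventually)
  show "((\<lambda>z. pairing (solution w \<psi>) (solution z \<psi>)) \<longlongrightarrow> pairing (solution w \<psi>) (solution w \<psi>)) (at w within {z. 0 \<le> Im z})"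
    by (intro tendsto_pairing tendsto_const tendsto_solution w)
  show "\<forall>\<^sub>F z in at w within {z. 0 \<le> Im z}.
      pairing (solution w \<psi>) (solution z \<psi>) = (herglotz \<psi> z - herglotz \<psi> w) / (z - w)"
    using herglotz_diff[OF _ w] by (auto simp: eventually_at_filter)
qed

lemma herglotz_real_derivative:
  "((\<lambda>s. Im (herglotz \<psi> (of_real s))) has_real_derivative
     Im (pairing (solution (of_real s) \<psi>) (solution (of_real s) \<psi>))) (at s)"
  unfolding has_field_derivative_iff
proof (rule Lim_transform_eventually)
  \<comment> \<open>Along the real axis \<open>t\<close> approaches \<open>s\<close> inside the
    closed half-plane, so \<open>tendsto_solution\<close> applies.\<close>
  have "filterlim complex_of_real (at (of_real s) within {z. 0 \<le> Im z}) (at s)"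
    unfolding filterlim_at by (auto intro!: tendsto_intros simp: eventually_at_filter)
  from filterlim_compose[OF tendsto_solution this, of \<psi>]
  have lim: "((\<lambda>t. solution (complex_of_real t) \<psi>) \<longlongrightarrow> solution (of_real s) \<psi>) (at s)"
    by simp
  show "((\<lambda>t. Im (pairing (solution (of_real s) \<psi>) (solution (of_real t) \<psi>)))
      \<longlongrightarrow> Im (pairing (solution (of_real s) \<psi>) (solution (of_real s) \<psi>))) (at s)"
    by (intro tendsto_Im tendsto_pairing tendsto_const lim)
  have "Im (herglotz \<psi> (of_real t)) - Im (herglotz \<psi> (of_real s))
      = (t - s) * Im (pairing (solution (of_real s) \<psi>) (solution (of_real t) \<psi>))" for t
    using arg_cong[OF herglotz_diff[of "of_real t" "of_real s" \<psi>], of Im]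
    by simp
  then show "\<forall>\<^sub>F t in at s. Im (pairing (solution (of_real s) \<psi>) (solution (of_real t) \<psi>))
      = (Im (herglotz \<psi> (of_real t)) - Im (herglotz \<psi> (of_real s))) / (t - s)"
    by (auto simp: eventually_at_filter)
qed

lemma Im_herglotz_nonneg: "0 \<le> Im (herglotz \<psi> (of_real s))"
  by (simp add: Im_herglotz_energy)

text \<open>The left side is the modulus of the derivative of \<open>Im H\<close> on the real axis.
  It equals \<open>2 * \<bar>inner v (B u)\<bar>\<close>, and \<open>2 * norm v * norm u\<close> is
  at most the sum of squares, which is \<open>Im H\<close> there.\<close>

lemma herglotz_log_lipschitz:
  "\<bar>Im (pairing (solution (of_real s) \<psi>) (solution (of_real s) \<psi>))\<bar> \<le> onorm B * Im (herglotz \<psi> (of_real s))"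
proof -
  let ?v = "fst (solution (of_real s) \<psi>)" and ?u = "snd (solution (of_real s) \<psi>)"
  have "\<bar>Im (pairing (solution (of_real s) \<psi>) (solution (of_real s) \<psi>))\<bar> = 2 * \<bar>inner ?v (B ?u)\<bar>"
    using symmetric[of ?v ?u] by (simp add: pairing_def inner_commute)
  also have "\<dots> \<le> 2 * (norm ?v * (onorm B * norm ?u))"
    using Cauchy_Schwarz_ineq2[of ?v "B ?u"] mult_left_mono[OF norm_B_le[of ?u] norm_ge_zero[of ?v]] by linarith
  also have "\<dots> = onorm B * (2 * norm ?v * norm ?u)"
    by simp
  also have "\<dots> \<le> onorm B * ((norm ?v)\<^sup>2 + (norm ?u)\<^sup>2)"
    by (intro mult_left_mono sum_squares_bound onorm_nonneg)
  also have "\<dots> = onorm B * Im (herglotz \<psi> (of_real s))"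
    by (simp add: Im_herglotz_energy norm_prod_def)
  finally show ?thesis .
qed

text \<open>With \<open>h = inner (B \<phi>) u\<close>, the Cauchy-Schwarz inequality for the form
  bounds \<open>h\<^sup>2\<close> by \<open>inner (B \<phi>) \<phi> * inner (B u) u\<close>, and the
  energy identity gives \<open>\<eta> * inner (B u) u \<le> h\<close>; one factor \<open>h\<close>
  then cancels unless it is 0. This is where the special vector \<open>B \<phi>\<close>
  enters.\<close>

lemma herglotz_decay:
  assumes \<eta>: "0 < \<eta>"
  shows "\<eta> * Im (herglotz (B \<phi>) (\<i> * of_real \<eta>)) \<le> inner (B \<phi>) \<phi>"
proof -
  let ?z = "\<i> * complex_of_real \<eta>"
  let ?v = "fst (solution ?z (B \<phi>))" and ?u = "snd (solution ?z (B \<phi>))"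
  define h where "h = Im (herglotz (B \<phi>) ?z)"
  have energy: "h = (norm (solution ?z (B \<phi>)))\<^sup>2 + \<eta> * (inner (B ?v) ?v + inner (B ?u) ?u)"
    using Im_herglotz_energy[of ?z "B \<phi>"] \<eta> by (simp add: h_def)
  have "0 \<le> \<eta> * inner (B ?v) ?v" "0 \<le> \<eta> * inner (B ?u) ?u"
    using nonneg \<eta> by simp_all
  then have h: "0 \<le> h" "\<eta> * inner (B ?u) ?u \<le> h"
    using energy by (simp_all add: distrib_left)
  have "(\<eta> * h) * h = \<eta> * (inner (B \<phi>) ?u)\<^sup>2"
    by (simp add: h_def herglotz_def power2_eq_square)
  also have "\<dots> \<le> inner (B \<phi>) \<phi> * (\<eta> * inner (B ?u) ?u)"
    using mult_left_mono[OF cauchy_schwarz_form[of \<phi> ?u], of \<eta>] \<eta> by (simp add: algebra_simps)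
  also have "\<dots> \<le> inner (B \<phi>) \<phi> * h"
    using h nonneg by (intro mult_left_mono)
  finally show ?thesis
    using h(1) nonneg[of \<phi>] by (cases "h = 0") (auto simp flip: h_def)
qed

lemma integral_herglotz_le:
  "integral {-N..N} (\<lambda>s. Im (herglotz (B \<phi>) (of_real s))) \<le> pi * inner (B \<phi>) \<phi>"
proof (rule nonneg_boundary_integral_le)
  show "continuous_on {z. 0 \<le> Im z} (herglotz (B \<phi>))"
    using herglotz_has_derivative by (intro DERIV_continuous_on) auto
  show "herglotz (B \<phi>) holomorphic_on {z. 0 < Im z}"
    unfolding holomorphic_on_def field_differentiable_def
    by (intro ballI exI, rule has_field_derivative_subset[OF herglotz_has_derivative]) auto
qed (auto intro: norm_herglotz_le Im_herglotz_nonneg herglotz_decay nonneg)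

section \<open>Identification with the resolvent of the squared operator\<close>

lemma sq_resolvent_eq_solution:
  "sq_resolvent D (\<lambda>x. A x + s *\<^sub>R B x) \<psi> = snd (solution (of_real s) \<psi>)"
proof -
  define T where "T = (\<lambda>x. A x + s *\<^sub>R B x)"
  note subD = self_adjoint_op_subspace[OF self_adjoint]
  have T_sym: "inner (T x) y = inner x (T y)" if "x \<in> D" "y \<in> D" for x y
    using that by (simp add: T_def inner_add_left inner_add_right symmetric self_adjoint_op_symmetric[OF self_adjoint])
  have T_diff: "T (x - y) = T x - T y" if "x \<in> D" "y \<in> D" for x y
    using that by (simp add: T_def self_adjoint_op_diff[OF self_adjoint] B_simps algebra_simps)
  obtain v u where x: "solution (of_real s) \<psi> = (v, u)"
    by fastforce
  \<comment> \<open>For real \<open>s\<close> the equation for \<open>dilation\<close> splits into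
    these two, so eliminating \<open>v\<close> shows that \<open>u\<close> solves the squared
    equation.\<close>
  have D: "v \<in> D" "u \<in> D" and eq: "T u = v" "T v + u = \<psi>"
    using solution[of "of_real s" \<psi>] x by (auto simp: dilation_def T_def algebra_simps)
  have "sq_resolvent D T \<psi> = u"
    unfolding sq_resolvent_def
  proof (rule the_equality)
    show "u \<in> D \<and> T u \<in> D \<and> T (T u) + u = \<psi>"
      using D eq by simp
    fix w assume w: "w \<in> D \<and> T w \<in> D \<and> T (T w) + w = \<psi>"
    define d where "d = w - u"
    have d: "d \<in> D" "T d \<in> D"
      using w D eq subspace_diff[OF subD] by (auto simp: d_def T_diff)
    \<comment> \<open>Uniqueness: pairing this with \<open>d\<close> gives
      \<open>(norm (T d))\<^sup>2 + (norm d)\<^sup>2 = 0\<close>.\<close>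
    have "T (T d) + d = 0"
      using w D eq by (simp add: d_def T_diff algebra_simps)
    then have "0 = inner (T (T d) + d) d"
      by simp
    also have "\<dots> = inner (T d) (T d) + inner d d"
      using T_sym[OF d(2,1)] by (simp add: inner_add_left)
    finally have "inner d d \<le> 0"
      using inner_ge_zero[of "T d"] by linarith
    then have "d = 0"
      by (metis inner_eq_zero_iff inner_ge_zero order_antisym)
    then show "w = u"
      by (simp add: d_def)
  qed
  then show ?thesis
    by (simp add: T_def x)
qed

lemma inner_sq_resolvent:
  "inner \<psi> (sq_resolvent D (\<lambda>x. A x + s *\<^sub>R B x) \<psi>) = Im (herglotz \<psi> (of_real s))"
  by (simp add: sq_resolvent_eq_solution herglotz_def)

end

section \<open>Summation of the suprema\<close>

theorem theorem3p1:
  fixes A B :: "'a::{real_inner, complete_space} \<Rightarrow> 'a" and D :: "'a set" and \<phi> :: 'a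
  assumes "separable_space TYPE('a)"
    and "self_adjoint_op D A"
    and "bounded_linear B"
    and "\<forall>x y. inner (B x) y = inner x (B y)"
    and "\<forall>x. inner (B x) x \<ge> 0"
  shows "(\<lambda>n::int. SUP y\<in>{0..1::real}.
            inner (B \<phi>) (sq_resolvent D (\<lambda>x. A x + (of_int n + y) *\<^sub>R B x) (B \<phi>)))
           summable_on UNIV
       \<and> (\<Sum>\<^sub>\<infinity>n::int. SUP y\<in>{0..1::real}.
            inner (B \<phi>) (sq_resolvent D (\<lambda>x. A x + (of_int n + y) *\<^sub>R B x) (B \<phi>)))
         \<le> pi * onorm B * (1 + onorm B) * (norm \<phi>)\<^sup>2"
proof -
  interpret perturbation A B D
    using assms by (simp add: perturbation_def)
  define f where "f = (\<lambda>s. Im (herglotz (B \<phi>) (of_real s)))"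
  define a where "a = (\<lambda>n::int. SUP y\<in>{0..1::real}. f (of_int n + y))"
  have f_nonneg: "0 \<le> f s" for s
    by (simp add: f_def Im_herglotz_nonneg)
  have sup_bound: "f y \<le> (1 + onorm B) * integral {c..c + 1} f" if "y \<in> {c..c + 1}" for y c
    using le_integral_unit_interval[OF herglotz_real_derivative herglotz_log_lipschitz
        Im_herglotz_nonneg onorm_nonneg that, of "B \<phi>"]
    by (simp add: f_def)
  have cont: "continuous_on UNIV f"
    unfolding f_def using herglotz_real_derivative by (meson DERIV_isCont continuous_at_imp_continuous_on)
  have a_le: "a n \<le> (1 + onorm B) * integral {of_int n..of_int n + 1} f" for n
    unfolding a_def by (intro cSUP_least sup_bound) auto
  have a_nonneg: "0 \<le> a n" for n
  proof -
    \<comment> \<open>A real \<open>SUP\<close> dominates its members only for a bounded family;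
      \<open>sup_bound\<close> supplies the boundedness, and \<open>y = 0\<close> is the member
      used.\<close>
    have "f (of_int n) \<le> a n"
      unfolding a_def
    proof (rule cSUP_upper2[of _ _ 0])
      show "bdd_above ((\<lambda>y. f (of_int n + y)) ` {0..1})"
        by (rule bdd_aboveI2[of _ _ "(1 + onorm B) * integral {of_int n..of_int n + 1} f"])
          (auto intro!: sup_bound)
    qed auto
    then show ?thesis
      using f_nonneg[of "of_int n"] by linarith
  qed
  \<comment> \<open>A bound uniform in \<open>F\<close> gives, for nonnegative terms, both
    summability and the estimate of the infinite sum.\<close>
  have finite_le: "sum a F \<le> pi * onorm B * (1 + onorm B) * (norm \<phi>)\<^sup>2" if "finite F" for F
  proof -
    have "inner (B \<phi>) \<phi> \<le> onorm B * norm \<phi> * norm \<phi>"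
      using norm_cauchy_schwarz[of "B \<phi>" \<phi>] mult_right_mono[OF norm_B_le[of \<phi>] norm_ge_zero[of \<phi>]]
      by linarith
    then have form_le: "pi * inner (B \<phi>) \<phi> \<le> pi * (onorm B * norm \<phi> * norm \<phi>)"
      by (intro mult_left_mono) auto
    have "sum a F \<le> (1 + onorm B) * (\<Sum>n\<in>F. integral {of_int n..of_int n + 1} f)"
      unfolding sum_distrib_left by (intro sum_mono a_le)
    also have "\<dots> \<le> (1 + onorm B) * (pi * (onorm B * norm \<phi> * norm \<phi>))"
    proof (rule mult_left_mono)
      have "(\<Sum>n\<in>F. integral {of_int n..of_int n + 1} f) \<le> pi * inner (B \<phi>) \<phi>"
        using integral_herglotz_le[of _ \<phi>] unfolding f_def[symmetric]
        by (rule sum_integrals_unit_intervals_le[OF cont f_nonneg _ that])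
      then show "(\<Sum>n\<in>F. integral {of_int n..of_int n + 1} f) \<le> pi * (onorm B * norm \<phi> * norm \<phi>)"
        using form_le by (rule order_trans)
    qed (use onorm_nonneg in simp)
    also have "\<dots> = pi * onorm B * (1 + onorm B) * (norm \<phi>)\<^sup>2"
      unfolding power2_eq_square by (simp only: ac_simps)
    finally show ?thesis .
  qed
  have "bdd_above (sum a ` {F. F \<subseteq> UNIV \<and> finite F})"
    by (rule bdd_aboveI2, rule finite_le) blast
  then have "a summable_on UNIV"
    by (rule nonneg_bdd_above_summable_on[OF a_nonneg])
  moreover from this have "infsum a UNIV \<le> pi * onorm B * (1 + onorm B) * (norm \<phi>)\<^sup>2"
    using finite_le by (rule infsum_le_finite_sums)
  ultimately show ?thesis
    unfolding inner_sq_resolvent a_def f_def by (rule conjI)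
qed

end
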